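(* There is an absolute constant $\delta \geq 10^{-9}$ such that for all sufficiently large integers $c$, there exist finite simple graphs $G,H$ with $\chi(G)\geq (1+\delta)c$, $\chi(H)\geq (1+\delta)c$, and $\chi(G\times H)\leq c$.
   Context: For finite graphs $G$ and $H$, the tensor product $G\times H$ is the graph on vertex set $V(G)\times V(H)$ in which $(g_1,h_1)$ and $(g_2,h_2)$ are adjacent if and only if $g_1\sim g_2$ in $G$ and $h_1\sim h_2$ in $H$. $\chi$ denotes the chromatic number. *)

theory Defs
  imports Complex_Main
begin

definition simple_graph :: "'a set \<Rightarrow> ('a \<Rightarrow> 'a \<Rightarrow> bool) \<Rightarrow> bool" where
  "simple_graph V E \<longleftrightarrow> finite V \<and> (\<forall>x y. E x y \<longrightarrow> x \<in> V \<and> y \<in> V)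
     \<and> (\<forall>x y. E x y \<longrightarrow> E y x) \<and> (\<forall>x. \<not> E x x)"

definition proper_colouring :: "'a set \<Rightarrow> ('a \<Rightarrow> 'a \<Rightarrow> bool) \<Rightarrow> nat \<Rightarrow> ('a \<Rightarrow> nat) \<Rightarrow> bool" where
  "proper_colouring V E k f \<longleftrightarrow> (\<forall>v\<in>V. f v < k) \<and> (\<forall>x y. E x y \<longrightarrow> f x \<noteq> f y)"

definition chromatic_number :: "'a set \<Rightarrow> ('a \<Rightarrow> 'a \<Rightarrow> bool) \<Rightarrow> nat" where
  "chromatic_number V E = (LEAST k. \<exists>f. proper_colouring V E k f)"

definition tensor_vertices :: "'a set \<Rightarrow> 'b set \<Rightarrow> ('a \<times> 'b) set" where
  "tensor_vertices VG VH = VG \<times> VH"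

definition tensor_edges :: "('a \<Rightarrow> 'a \<Rightarrow> bool) \<Rightarrow> ('b \<Rightarrow> 'b \<Rightarrow> bool) \<Rightarrow> ('a \<times> 'b) \<Rightarrow> ('a \<times> 'b) \<Rightarrow> bool" where
  "tensor_edges EG EH = (\<lambda>(g1, h1) (g2, h2). EG g1 g2 \<and> EH h1 h2)"

end

(*
  Let G be the m-th strong power of the 9-cycle and G[q] its blow-up by cliques of size q, where c is
  about 3 * 2^m * q, and let H be the exponential graph: its vertices are the maps from G[q] to
  c colours, and phi ~ psi iff phi u <> psi v for every edge uv.  Evaluation c-colours G[q] x H.

  chi(G[q]): the closed neighbourhood structure of the 9-cycle has a vector representation whose
  Lovasz-type weight exceeds 2.  It is multiplicative, so independent sets of G have weight at most 1
  while the total weight is (127/63)^m, whereas balls of radius 3 in G need only 2^m colours.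

  chi(H): given a colouring of H, a large colour class of maps V(G) -> [c] must consist of maps
  attaining one fixed value b somewhere on one fixed closed neighbourhood.  Counting then gives a vertex x such that for
  almost all b the class of the constant map b consists of maps attaining b within distance 2 of x.
  Properly colour the ball of radius 3 by few colours and put t outside (mu t); these maps form a
  clique, so for many t the map mu t shares its colour with the constant t.  The maps nu t equal to
  t on the ball of radius 2 and to some other g t outside are adjacent to mu t, so they avoid the
  colour of t, and they avoid that of g t by the choice of x.  They form a clique, which requires many
  colours beyond those of the c constant maps.
*)
theory Submission
  imports Defs "HOL-Library.FuncSet"
begin

section \<open>Robust colour classes of exponential graphs\<close>

definition colour_maps :: "'a set \<Rightarrow> nat \<Rightarrow> ('a \<Rightarrow> nat) set" where
  "colour_maps V c = V \<rightarrow>\<^sub>E {..<c}"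

text \<open>Used below both for a reflexive relation \<open>R\<close>, where adjacent maps must also
  differ pointwise, and for its loopless blow-up.\<close>

definition exp_edges :: "'a set \<Rightarrow> ('a \<Rightarrow> 'a \<Rightarrow> bool) \<Rightarrow> nat \<Rightarrow> ('a \<Rightarrow> nat) \<Rightarrow> ('a \<Rightarrow> nat) \<Rightarrow> bool" where
  "exp_edges V E c \<phi> \<psi> \<longleftrightarrow> \<phi> \<in> colour_maps V c \<and> \<psi> \<in> colour_maps V c \<and> (\<forall>x y. E x y \<longrightarrow> \<phi> x \<noteq> \<psi> y)"

lemma finite_maps: "finite V \<Longrightarrow> finite (colour_maps V c)"
  by (simp add: colour_maps_def finite_PiE)

lemma card_maps_fix2:
  assumes "finite V" "x \<in> V" "y \<in> V" "x \<noteq> y"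
  shows "card {\<phi> \<in> colour_maps V c. \<phi> x = a \<and> \<phi> y = b} \<le> c ^ (card V - 2)"
proof -
  define T where "T = (\<lambda>v. if v = x then {a} else if v = y then {b} else {..<c})"
  have "{\<phi> \<in> colour_maps V c. \<phi> x = a \<and> \<phi> y = b} \<subseteq> PiE V T"
    unfolding colour_maps_def T_def by (auto simp: PiE_iff extensional_def)
  then have "card {\<phi> \<in> colour_maps V c. \<phi> x = a \<and> \<phi> y = b} \<le> card (PiE V T)"
    using assms(1) by (intro card_mono finite_PiE) (auto simp: T_def)
  also have "card (PiE V T) = (\<Prod>v\<in>V. card (T v))"
    using assms(1) by (rule card_PiE)
  also have "\<dots> = (\<Prod>v\<in>V - {x, y}. card (T v))"
    using assms by (intro prod.mono_neutral_right) (auto simp: T_def)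
  also have "\<dots> = (\<Prod>v\<in>V - {x, y}. c)"
    by (intro prod.cong) (auto simp: T_def)
  also have "\<dots> = c ^ (card V - 2)"
    using assms by (simp add: card_Diff_subset numeral_2_eq_2)
  finally show ?thesis .
qed

text \<open>\<open>\<Phi>\<close> is a hypothetical \<open>k\<close>-colouring, to be refuted for
  suitable parameters. In the application \<open>R\<close> is reflexive, so \<open>R x\<close> is a
  closed neighbourhood.\<close>

locale exponential_colouring =
  fixes V :: "'a set" and R :: "'a \<Rightarrow> 'a \<Rightarrow> bool" and c k :: nat and \<Phi> :: "('a \<Rightarrow> nat) \<Rightarrow> nat"
  assumes finite_V: "finite V"
    and R_V: "R x y \<Longrightarrow> x \<in> V \<and> y \<in> V"
    and R_sym: "R x y \<Longrightarrow> R y x"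
    and colour_less: "\<phi> \<in> colour_maps V c \<Longrightarrow> \<Phi> \<phi> < k"
    and colour_proper: "exp_edges V R c \<phi> \<psi> \<Longrightarrow> \<Phi> \<phi> \<noteq> \<Phi> \<psi>"
begin

definition cls :: "nat \<Rightarrow> ('a \<Rightarrow> nat) set" where
  "cls j = {\<phi> \<in> colour_maps V c. \<Phi> \<phi> = j}"

definition robust :: "nat \<Rightarrow> 'a \<Rightarrow> nat \<Rightarrow> bool" where
  "robust j y b \<longleftrightarrow> (\<forall>\<psi>\<in>cls j. \<exists>z. R y z \<and> \<psi> z = b)"

lemma finite_cls: "finite (cls j)"
  using finite_maps[OF finite_V] by (simp add: cls_def)

lemma cls_meet:
  assumes "\<phi> \<in> cls j" "\<psi> \<in> cls j"
  obtains x z where "x \<in> V" "z \<in> V" "R x z" "\<phi> x = \<psi> z"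
  using assms colour_proper[of \<phi> \<psi>] R_V unfolding cls_def exp_edges_def by auto

text \<open>A map in the class missing \<open>b\<close> near \<open>y\<close> would be adjacent to all but few maps with value \<open>b\<close> at \<open>y\<close>.\<close>

lemma popular_imp_robust:
  assumes y: "y \<in> V" and big: "card V ^ 2 * c ^ (card V - 2) < card {\<phi> \<in> cls j. \<phi> y = b}"
  shows "robust j y b"
  unfolding robust_def
proof (rule ballI, rule ccontr)
  fix \<psi> assume \<psi>: "\<psi> \<in> cls j" and no: "\<not> (\<exists>z. R y z \<and> \<psi> z = b)"
  define U where "U = (\<lambda>(x, z). {\<phi> \<in> colour_maps V c. \<phi> x = \<psi> z \<and> \<phi> y = b})"
  \<comment> \<open>Each such map meets \<open>\<psi>\<close> at some related pair
    \<open>(x, z)\<close>. Here \<open>x = y\<close> would give \<open>\<psi> z = b\<close> near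
    \<open>y\<close>, so two distinct coordinates are prescribed.\<close>
  have "{\<phi> \<in> cls j. \<phi> y = b} \<subseteq> (\<Union>p\<in>(V - {y}) \<times> V. U p)"
  proof
    fix \<phi> assume "\<phi> \<in> {\<phi> \<in> cls j. \<phi> y = b}"
    then have \<phi>: "\<phi> \<in> cls j" "\<phi> y = b" by auto
    obtain x z where xz: "x \<in> V" "z \<in> V" "R x z" "\<phi> x = \<psi> z"
      using cls_meet[OF \<phi>(1) \<psi>] .
    with no \<phi>(2) have "x \<noteq> y" by auto
    with xz \<phi> show "\<phi> \<in> (\<Union>p\<in>(V - {y}) \<times> V. U p)"
      by (auto simp: U_def cls_def)
  qed
  then have "card {\<phi> \<in> cls j. \<phi> y = b} \<le> card (\<Union>p\<in>(V - {y}) \<times> V. U p)"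
    by (intro card_mono finite_UN_I) (auto simp: finite_V U_def finite_maps)
  also have "\<dots> \<le> (\<Sum>p\<in>(V - {y}) \<times> V. card (U p))"
    by (intro card_UN_le) (simp add: finite_V)
  also have "\<dots> \<le> (\<Sum>p\<in>(V - {y}) \<times> V. c ^ (card V - 2))"
    using y by (intro sum_mono) (auto simp: U_def intro!: card_maps_fix2 finite_V)
  also have "\<dots> = card (V - {y}) * card V * c ^ (card V - 2)"
    by (simp add: card_cartesian_product)
  also have "\<dots> \<le> card V ^ 2 * c ^ (card V - 2)"
    unfolding power2_eq_square by (intro mult_right_mono card_mono finite_V) auto
  finally show False using big by simp
qed

text \<open>One fixed member \<open>\<psi>\<close> meets every member of the class, so one of the
  \<open>card V ^ 2\<close> pairs \<open>(x, z)\<close> has many members with value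
  \<open>\<psi> z\<close> at \<open>x\<close>, and \<open>popular_imp_robust\<close> applies
  there.\<close>

lemma large_cls_imp_robust:
  assumes big: "card V ^ 4 * c ^ (card V - 2) < card (cls j)"
  shows "\<exists>y\<in>V. \<exists>b. robust j y b"
proof (rule ccontr)
  assume no: "\<not> (\<exists>y\<in>V. \<exists>b. robust j y b)"
  from big have "cls j \<noteq> {}" by auto
  then obtain \<psi> where \<psi>: "\<psi> \<in> cls j" by auto
  have "cls j \<subseteq> (\<Union>p\<in>V \<times> V. {\<phi> \<in> cls j. \<phi> (fst p) = \<psi> (snd p)})"
  proof
    fix \<phi> assume \<phi>: "\<phi> \<in> cls j"
    obtain x z where "x \<in> V" "z \<in> V" "\<phi> x = \<psi> z" using cls_meet[OF \<phi> \<psi>] .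
    then show "\<phi> \<in> (\<Union>p\<in>V \<times> V. {\<phi> \<in> cls j. \<phi> (fst p) = \<psi> (snd p)})"
      using \<phi> by (auto intro!: bexI[of _ "(x, z)"])
  qed
  then have "card (cls j) \<le> card (\<Union>p\<in>V \<times> V. {\<phi> \<in> cls j. \<phi> (fst p) = \<psi> (snd p)})"
    by (intro card_mono finite_UN_I) (auto simp: finite_V finite_cls)
  also have "\<dots> \<le> (\<Sum>p\<in>V \<times> V. card {\<phi> \<in> cls j. \<phi> (fst p) = \<psi> (snd p)})"
    by (intro card_UN_le) (simp add: finite_V)
  also have "\<dots> \<le> (\<Sum>p\<in>V \<times> V. card V ^ 2 * c ^ (card V - 2))"
  proof (intro sum_mono)
    fix p assume "p \<in> V \<times> V"
    then show "card {\<phi> \<in> cls j. \<phi> (fst p) = \<psi> (snd p)} \<le> card V ^ 2 * c ^ (card V - 2)"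
      using no popular_imp_robust[of "fst p" j "\<psi> (snd p)"] by (auto simp: not_less[symmetric])
  qed
  also have "\<dots> = card V ^ 4 * c ^ (card V - 2)"
    by (simp add: card_cartesian_product power2_eq_square power4_eq_xxxx)
  finally show False using big by simp
qed

text \<open>If every \<open>x\<close> left at least \<open>h\<close> values outside those forced by
  robust classes centred near it, the maps using only such values would number at least
  \<open>h ^ card V\<close> and all lie in small classes, which cannot hold that many.\<close>

lemma robust_vertex_indexed:
  assumes h: "k * card V ^ 4 * c ^ (card V - 2) < h ^ card V"
  obtains Y Bf L x where "x \<in> V" "\<And>j. j \<in> L \<Longrightarrow> robust j (Y j) (Bf j)" "L \<subseteq> {..<k}"
    "card ({..<c} - Bf ` {j \<in> L. R x (Y j)}) < h"
proof -
  define L where "L = {j\<in>{..<k}. card V ^ 4 * c ^ (card V - 2) < card (cls j)}"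
  have "\<forall>j\<in>L. \<exists>y. \<exists>b. robust j y b"
    using large_cls_imp_robust by (fastforce simp: L_def)
  then obtain Y Bf where YB: "\<And>j. j \<in> L \<Longrightarrow> robust j (Y j) (Bf j)"
    by metis
  define A where "A = (\<lambda>x. Bf ` {j \<in> L. R x (Y j)})"
  have "\<exists>x\<in>V. card ({..<c} - A x) < h"
  proof (rule ccontr)
    assume "\<not> ?thesis"
    then have ge: "\<And>x. x \<in> V \<Longrightarrow> h \<le> card ({..<c} - A x)" by (auto simp: not_less)
    have "h ^ card V = (\<Prod>x\<in>V. h)" by simp
    also have "\<dots> \<le> (\<Prod>x\<in>V. card ({..<c} - A x))"
      by (intro prod_mono) (auto simp: ge)
    also have "\<dots> = card (PiE V (\<lambda>x. {..<c} - A x))"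
      by (rule card_PiE[symmetric, OF finite_V])
    also have "\<dots> \<le> card (\<Union>j\<in>{..<k} - L. cls j)"
    proof (rule card_mono)
      show "finite (\<Union>j\<in>{..<k} - L. cls j)" by (auto simp: finite_cls)
      show "PiE V (\<lambda>x. {..<c} - A x) \<subseteq> (\<Union>j\<in>{..<k} - L. cls j)"
      proof
        fix \<phi> assume \<phi>: "\<phi> \<in> PiE V (\<lambda>x. {..<c} - A x)"
        then have m: "\<phi> \<in> colour_maps V c" by (auto simp: colour_maps_def PiE_iff)
        then have cl: "\<phi> \<in> cls (\<Phi> \<phi>)" "\<Phi> \<phi> < k" using colour_less by (auto simp: cls_def)
        \<comment> \<open>A large class forces its value \<open>Bf\<close> at some \<open>z\<close>
          near its centre \<open>Y\<close>, and by symmetry that value belongs to the forbidden set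
          \<open>A z\<close>.\<close>
        have "\<Phi> \<phi> \<notin> L"
        proof
          assume L: "\<Phi> \<phi> \<in> L"
          then obtain z where z: "R (Y (\<Phi> \<phi>)) z" "\<phi> z = Bf (\<Phi> \<phi>)"
            using YB[OF L] cl(1) by (auto simp: robust_def)
          then have "\<phi> z \<in> A z" using L R_sym by (auto simp: A_def)
          moreover have "z \<in> V" using z R_V by auto
          ultimately show False using \<phi> by (auto simp: PiE_iff)
        qed
        with cl show "\<phi> \<in> (\<Union>j\<in>{..<k} - L. cls j)" by auto
      qed
    qed
    also have "\<dots> \<le> (\<Sum>j\<in>{..<k} - L. card (cls j))"
      by (intro card_UN_le) simp
    also have "\<dots> \<le> (\<Sum>j\<in>{..<k} - L. card V ^ 4 * c ^ (card V - 2))"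
      by (intro sum_mono) (auto simp: L_def)
    also have "\<dots> = card ({..<k} - L) * (card V ^ 4 * c ^ (card V - 2))"
      by simp
    also have "\<dots> \<le> k * (card V ^ 4 * c ^ (card V - 2))"
      using card_mono[of "{..<k}" "{..<k} - L"] by (intro mult_right_mono) auto
    finally show False using h by simp
  qed
  then show ?thesis using that[of _ L Y Bf] YB unfolding A_def by (auto simp: L_def)
qed

abbreviation "const b \<equiv> restrict (\<lambda>_. b) V"

lemma const_maps: "b < c \<Longrightarrow> const b \<in> colour_maps V c"
  by (auto simp: colour_maps_def)

text \<open>The constants form a clique, so precisely \<open>k - c\<close> colours remain that no
  constant uses.\<close>

lemma inj_on_const_colour: "inj_on (\<lambda>b. \<Phi> (const b)) {..<c}"
proof (rule inj_onI, rule ccontr)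
  fix a b assume ab: "a \<in> {..<c}" "b \<in> {..<c}" "\<Phi> (const a) = \<Phi> (const b)" "a \<noteq> b"
  then have "exp_edges V R c (const a) (const b)"
    using const_maps R_V by (fastforce simp: exp_edges_def)
  then show False using colour_proper ab by blast
qed

text \<open>Replaces class indices by constants: if a class robust with value \<open>b\<close>
  contains a constant, that constant is \<open>const b\<close>. The classes without a constant spoil
  at most \<open>k - c\<close> further values.\<close>

lemma robust_vertex:
  assumes h: "k * card V ^ 4 * c ^ (card V - 2) < h ^ card V"
  obtains x where "x \<in> V"
    "card {b\<in>{..<c}. \<exists>\<psi>\<in>colour_maps V c. \<Phi> \<psi> = \<Phi> (const b) \<and> (\<forall>y z. R x y \<longrightarrow> R y z \<longrightarrow> \<psi> z \<noteq> b)}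
       < h + (k - c)"
proof -
  obtain Y Bf L x where x: "x \<in> V" and rob: "\<And>j. j \<in> L \<Longrightarrow> robust j (Y j) (Bf j)"
    and L: "L \<subseteq> {..<k}" and few: "card ({..<c} - Bf ` {j \<in> L. R x (Y j)}) < h"
    by (rule robust_vertex_indexed[OF h]) (rule that)
  define P where "P = (\<lambda>b. \<Phi> (const b)) ` {..<c}"
  have P: "P \<subseteq> {..<k}" "card P = c"
    using colour_less const_maps card_image[OF inj_on_const_colour] by (auto simp: P_def)
  define bad where "bad = {b\<in>{..<c}. \<exists>\<psi>\<in>colour_maps V c. \<Phi> \<psi> = \<Phi> (const b) \<and>
      (\<forall>y z. R x y \<longrightarrow> R y z \<longrightarrow> \<psi> z \<noteq> b)}"
  have "bad \<subseteq> ({..<c} - Bf ` {j \<in> L. R x (Y j)}) \<union> Bf ` ({..<k} - P)"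
  proof
    fix b assume b: "b \<in> bad"
    then obtain \<psi> where \<psi>: "\<psi> \<in> colour_maps V c" "\<Phi> \<psi> = \<Phi> (const b)"
      "\<And>y z. R x y \<Longrightarrow> R y z \<Longrightarrow> \<psi> z \<noteq> b" and "b < c" by (auto simp: bad_def)
    show "b \<in> ({..<c} - Bf ` {j \<in> L. R x (Y j)}) \<union> Bf ` ({..<k} - P)"
    proof (cases "b \<in> Bf ` {j \<in> L. R x (Y j)}")
      case False
      then show ?thesis using \<open>b < c\<close> by auto
    next
      case True
      then obtain j where j: "j \<in> L" "R x (Y j)" "b = Bf j" by auto
      have "j \<notin> P"
      proof
        assume "j \<in> P"
        then obtain i where i: "i < c" "j = \<Phi> (const i)" by (auto simp: P_def)
        then have "const i \<in> cls j" using const_maps by (auto simp: cls_def)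
        then have "i = b" using rob[OF j(1)] j(3) R_V unfolding robust_def by fastforce
        then have "\<psi> \<in> cls j" using \<psi> i by (auto simp: cls_def)
        then show False using rob[OF j(1)] j \<psi>(3) unfolding robust_def by blast
      qed
      then show ?thesis using j L by auto
    qed
  qed
  then have "card bad \<le> card (({..<c} - Bf ` {j \<in> L. R x (Y j)}) \<union> Bf ` ({..<k} - P))"
    by (intro card_mono) auto
  also have "\<dots> \<le> card ({..<c} - Bf ` {j \<in> L. R x (Y j)}) + card (Bf ` ({..<k} - P))"
    by (rule card_Un_le)
  also have "card (Bf ` ({..<k} - P)) \<le> card ({..<k} - P)"
    by (intro card_image_le) simp
  also have "\<dots> = k - c"
    using P by (subst card_Diff_subset) (auto intro: finite_subset)
  finally have "card bad < h + (k - c)" using few by simp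
  then show ?thesis using that x by (simp add: bad_def)
qed

end

section \<open>Clique blow-ups and the lower bound for their exponential graphs\<close>

text \<open>For reflexive \<open>R\<close> the \<open>q\<close> copies of a vertex form a clique;
  \<open>u \<noteq> v\<close> only removes loops.\<close>

definition blowup :: "('a \<Rightarrow> 'a \<Rightarrow> bool) \<Rightarrow> nat \<Rightarrow> 'a \<times> nat \<Rightarrow> 'a \<times> nat \<Rightarrow> bool" where
  "blowup R q u v \<longleftrightarrow> R (fst u) (fst v) \<and> snd u < q \<and> snd v < q \<and> u \<noteq> v"

text \<open>Only \<open>k - c\<close> colours are used by no constant, and a clique of
  \<open>k - c + 1\<close> maps \<open>\<nu> t\<close> is confined to them. \<open>c1\<close> yields
  enough \<open>t\<close> with \<open>\<mu> t\<close> coloured like the constant \<open>t\<close>;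
  \<open>c2\<close> leaves room for the second values \<open>g t\<close>.\<close>

lemma exp_graph_not_colourable:
  fixes V :: "'a set"
  assumes V: "finite V"
    and R_V: "\<And>x y. R x y \<Longrightarrow> x \<in> V \<and> y \<in> V"
    and R_refl: "\<And>x. x \<in> V \<Longrightarrow> R x x"
    and R_sym: "\<And>x y. R x y \<Longrightarrow> R y x"
    and ball_col: "\<And>x. x \<in> V \<Longrightarrow> \<exists>col. (\<forall>a. col a < K) \<and>
       (\<forall>a b. a \<noteq> b \<longrightarrow> R a b \<longrightarrow> (\<exists>y z. R x y \<and> R y z \<and> R z a) \<longrightarrow>
          (\<exists>y z. R x y \<and> R y z \<and> R z b) \<longrightarrow> col a \<noteq> (col b :: nat))"
    and h: "k * card V ^ 4 * c ^ (card V - 2) < h ^ card V"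
    and c1: "2 * (K * q) + 2 * (k - c) < c"
    and c2: "K * q + h + 3 * (k - c) + 2 \<le> c"
  shows "\<not> proper_colouring (colour_maps (V \<times> {..<q}) c) (exp_edges (V \<times> {..<q}) (blowup R q) c) k f"
proof
  define W where "W = V \<times> {..<q}"
  assume "proper_colouring (colour_maps (V \<times> {..<q}) c) (exp_edges (V \<times> {..<q}) (blowup R q) c) k f"
  then have f_less: "\<And>\<phi>. \<phi> \<in> colour_maps W c \<Longrightarrow> f \<phi> < k"
    and f_proper: "\<And>\<phi> \<psi>. exp_edges W (blowup R q) c \<phi> \<psi> \<Longrightarrow> f \<phi> \<noteq> f \<psi>"
    by (auto simp: proper_colouring_def W_def)
  have edge_W: "u \<in> W \<and> v \<in> W" if "blowup R q u v" for u v
    using that R_V by (cases u; cases v) (auto simp: W_def blowup_def)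
  \<comment> \<open>Blow-up edges project to \<open>R\<close>-related vertices, so lifting preserves
    adjacency. The counting thus takes place on \<open>V\<close>, whose size need not grow with
    \<open>q\<close>.\<close>
  define lift where "lift = (\<lambda>\<phi> :: 'a \<Rightarrow> nat. restrict (\<phi> \<circ> fst) W)"
  have lift_maps: "lift \<phi> \<in> colour_maps W c" if "\<phi> \<in> colour_maps V c" for \<phi>
    using that by (auto simp: colour_maps_def lift_def W_def PiE_iff)
  have lift_app: "lift \<phi> u = \<phi> (fst u)" if "u \<in> W" for \<phi> u
    using that by (simp add: lift_def)
  define \<Phi> where "\<Phi> = (\<lambda>\<phi>. f (lift \<phi>))"
  interpret exponential_colouring V R c k \<Phi>
  proof
    show "\<Phi> \<phi> < k" if "\<phi> \<in> colour_maps V c" for \<phi>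
      using f_less lift_maps that by (simp add: \<Phi>_def)
    show "\<Phi> \<phi> \<noteq> \<Phi> \<psi>" if "exp_edges V R c \<phi> \<psi>" for \<phi> \<psi>
    proof -
      have "exp_edges W (blowup R q) c (lift \<phi>) (lift \<psi>)"
        unfolding exp_edges_def
      proof (intro conjI allI impI)
        fix u v assume uv: "blowup R q u v"
        then have "R (fst u) (fst v)" by (simp add: blowup_def)
        then show "lift \<phi> u \<noteq> lift \<psi> v"
          using that edge_W[OF uv] by (simp add: exp_edges_def lift_app)
      qed (use that lift_maps in \<open>auto simp: exp_edges_def\<close>)
      then show ?thesis using f_proper by (simp add: \<Phi>_def)
    qed
  qed (use V R_V R_sym in auto)
  define M where "M = K * q"
  define \<sigma> where "\<sigma> = k - c"
  define P where "P = (\<lambda>b. \<Phi> (const b)) ` {..<c}"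
  have P: "P \<subseteq> {..<k}" "card P = c"
    using colour_less const_maps card_image[OF inj_on_const_colour] by (auto simp: P_def)
  have card_sec: "card ({..<k} - P) = \<sigma>"
    using P by (subst card_Diff_subset) (auto intro: finite_subset simp: \<sigma>_def)
  \<comment> \<open>A map omitting the value \<open>b\<close> is adjacent to the constant
    \<open>b\<close>.\<close>
  have missing: "f \<psi> \<noteq> \<Phi> (const b)" if \<psi>: "\<psi> \<in> colour_maps W c" and b: "b < c" "\<And>u. u \<in> W \<Longrightarrow> \<psi> u \<noteq> b" for \<psi> b
  proof -
    have "exp_edges W (blowup R q) c \<psi> (lift (const b))"
      unfolding exp_edges_def
    proof (intro conjI allI impI)
      show "lift (const b) \<in> colour_maps W c" using lift_maps const_maps b by blast
      fix u v assume "blowup R q u v"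
      then have "u \<in> W" "v \<in> W" using edge_W by auto
      then show "\<psi> u \<noteq> lift (const b) v" using b(2)[of u] by (auto simp: lift_app W_def)
    qed (rule \<psi>)
    then show ?thesis using f_proper by (simp add: \<Phi>_def)
  qed
  obtain x where x: "x \<in> V" and few_bad:
    "card {b\<in>{..<c}. \<exists>\<psi>\<in>colour_maps V c. \<Phi> \<psi> = \<Phi> (const b) \<and> (\<forall>y z. R x y \<longrightarrow> R y z \<longrightarrow> \<psi> z \<noteq> b)}
       < h + \<sigma>"
    unfolding \<sigma>_def using robust_vertex[OF h] by blast
  define bad where "bad = {b\<in>{..<c}. \<exists>\<psi>\<in>colour_maps V c. \<Phi> \<psi> = \<Phi> (const b) \<and>
      (\<forall>y z. R x y \<longrightarrow> R y z \<longrightarrow> \<psi> z \<noteq> b)}"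
  \<comment> \<open>As \<open>R\<close> is reflexive, these are the balls of radius 2 and 3 around
    \<open>x\<close>.\<close>
  define B2 B3 where "B2 = (\<lambda>z. \<exists>y. R x y \<and> R y z)" and "B3 = (\<lambda>w. \<exists>y z. R x y \<and> R y z \<and> R z w)"
  obtain col where col_less: "\<And>a. col a < K"
    and col: "\<And>a b. a \<noteq> b \<Longrightarrow> R a b \<Longrightarrow> B3 a \<Longrightarrow> B3 b \<Longrightarrow> col a \<noteq> (col b :: nat)"
    using ball_col[OF x] unfolding B3_def by blast
  \<comment> \<open>Pairing \<open>col\<close> with the copy index colours the blown-up ball
    properly by numbers below \<open>M\<close>.\<close>
  have code_less: "col a * q + i < M" if "i < q" for a i
  proof -
    have "col a * q + i < Suc (col a) * q" using that by simp
    also have "\<dots> \<le> K * q" using col_less[of a] by (intro mult_right_mono) auto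
    finally show ?thesis by (simp add: M_def)
  qed
  have code_eq: "col a = col b \<and> i = j" if "i < q" "j < q" "col a * q + i = col b * q + j" for a b i j
  proof -
    have "col a = (col a * q + i) div q" using that(1) by simp
    also have "\<dots> = col b" using that(2) unfolding that(3) by simp
    finally show ?thesis using that(3) by simp
  qed
  have M_le: "M \<le> c" using c1 by (simp add: M_def)
  define \<mu> where "\<mu> = (\<lambda>t. restrict (\<lambda>(a, i). if B3 a then col a * q + i else t) W)"
  have \<mu>_maps: "\<mu> t \<in> colour_maps W c" if "t < c" for t
    using that order_less_le_trans[OF code_less M_le] by (auto simp: \<mu>_def colour_maps_def W_def)
  \<comment> \<open>Inside the ball the codes differ along edges, outside it \<open>t\<close> and
    \<open>s\<close> differ, and codes lie below \<open>M\<close> while \<open>t\<close> and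
    \<open>s\<close> do not.\<close>
  have \<mu>_adj: "exp_edges W (blowup R q) c (\<mu> t) (\<mu> s)" if "t \<in> {M..<c}" "s \<in> {M..<c}" "t \<noteq> s" for t s
    unfolding exp_edges_def
  proof (intro conjI allI impI)
    fix u v assume uv: "blowup R q u v"
    obtain a i b j where ab: "u = (a, i)" "v = (b, j)" by fastforce
    have ij: "i < q" "j < q" "R a b" "a \<noteq> b \<or> i \<noteq> j" using uv ab by (auto simp: blowup_def)
    have W: "(a, i) \<in> W" "(b, j) \<in> W" using edge_W[OF uv] ab by auto
    have "col a * q + i \<noteq> col b * q + j" if "B3 a" "B3 b"
      using code_eq[OF ij(1,2)] ij col[of a b] that by blast
    then show "\<mu> t u \<noteq> \<mu> s v"
      using W that code_less[OF ij(1), of a] code_less[OF ij(2), of b] by (auto simp: ab \<mu>_def)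
  qed (use that \<mu>_maps in auto)
  define T where "T = {t \<in> {M..<c}. f (\<mu> t) = \<Phi> (const t)}"
  \<comment> \<open>If \<open>\<mu> t\<close> shares the colour of the constant \<open>b\<close>,
    then \<open>b < M\<close> or \<open>b = t\<close>, all other values being omitted. So outside
    \<open>T\<close> this clique has at most \<open>M + \<sigma>\<close> colours available.\<close>
  have "card ({M..<c} - T) \<le> card ((\<lambda>b. \<Phi> (const b)) ` {..<M} \<union> ({..<k} - P))"
  proof (rule card_inj_on_le)
    show "inj_on (\<lambda>t. f (\<mu> t)) ({M..<c} - T)"
      using \<mu>_adj f_proper by (fastforce intro: inj_onI)
    show "(\<lambda>t. f (\<mu> t)) ` ({M..<c} - T) \<subseteq> (\<lambda>b. \<Phi> (const b)) ` {..<M} \<union> ({..<k} - P)"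
    proof (rule image_subsetI)
      fix t assume t: "t \<in> {M..<c} - T"
      have "f (\<mu> t) \<notin> P" if "f (\<mu> t) \<notin> (\<lambda>b. \<Phi> (const b)) ` {..<M}"
      proof
        assume "f (\<mu> t) \<in> P"
        then obtain b where b: "b < c" "f (\<mu> t) = \<Phi> (const b)" by (auto simp: P_def)
        then have "M \<le> b" "b \<noteq> t" using that t by (auto simp: T_def not_less[symmetric])
        then have "\<mu> t u \<noteq> b" if "u \<in> W" for u
          using that code_less[of "snd u" "fst u"] by (auto simp: \<mu>_def W_def split: if_splits)
        then show False using missing[of "\<mu> t" b] \<mu>_maps t b by auto
      qed
      moreover have "f (\<mu> t) < k" using f_less \<mu>_maps t by auto
      ultimately show "f (\<mu> t) \<in> (\<lambda>b. \<Phi> (const b)) ` {..<M} \<union> ({..<k} - P)" by auto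
    qed
  qed auto
  also have "\<dots> \<le> card ((\<lambda>b. \<Phi> (const b)) ` {..<M}) + card ({..<k} - P)"
    by (rule card_Un_le)
  also have "\<dots> \<le> M + \<sigma>"
    using card_image_le[of "{..<M}" "\<lambda>b. \<Phi> (const b)"] card_sec by simp
  finally have "card ({M..<c} - T) \<le> M + \<sigma>" .
  moreover have "card ({M..<c} - T) = (c - M) - card T"
    by (subst card_Diff_subset) (auto simp: T_def)
  ultimately have "\<sigma> + 1 \<le> card T"
    using c1 by (simp add: M_def \<sigma>_def)
  then obtain T' where T': "T' \<subseteq> T" "card T' = \<sigma> + 1" "finite T'"
    using obtain_subset_with_card_n by metis
  \<comment> \<open>By \<open>c2\<close> at least \<open>\<sigma> + 1\<close> values survive.
    Avoiding \<open>T'\<close> makes the pairs \<open>{t, g t}\<close> pairwise disjoint, so the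
    maps \<open>\<nu> t\<close> are pairwise adjacent.\<close>
  have "card ({M..<c} - (bad \<union> T')) \<ge> card {M..<c} - card (bad \<union> T')"
    by (rule diff_card_le_card_Diff) (use T' in \<open>auto simp: bad_def\<close>)
  moreover have "card (bad \<union> T') \<le> card bad + (\<sigma> + 1)"
    using card_Un_le[of bad T'] T' by simp
  ultimately have "\<sigma> + 1 \<le> card ({M..<c} - (bad \<union> T'))"
    using few_bad c2 unfolding bad_def[symmetric] by (simp add: M_def \<sigma>_def)
  then obtain S where S: "S \<subseteq> {M..<c} - (bad \<union> T')" "card S = \<sigma> + 1" "finite S"
    using obtain_subset_with_card_n by metis
  obtain g where g: "bij_betw g T' S"
    using finite_same_card_bij[of T' S] T' S by auto
  have gS: "g t \<in> {M..<c}" "g t \<notin> bad" "g t \<notin> T'" if "t \<in> T'" for t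
    using bij_betwE[OF g] that S by auto
  have tT: "t \<in> {M..<c}" "f (\<mu> t) = \<Phi> (const t)" if "t \<in> T'" for t
    using that T' by (auto simp: T_def)
  have g_ne: "g t \<noteq> s" if "t \<in> T'" "s \<in> T'" for s t
    using gS(3) that by blast
  define \<nu> where "\<nu> = (\<lambda>t. restrict (\<lambda>a. if B2 a then t else g t) V)"
  have \<nu>_maps: "\<nu> t \<in> colour_maps V c" if "t \<in> T'" for t
    using gS(1)[OF that] tT(1)[OF that] by (auto simp: \<nu>_def colour_maps_def)
  have \<nu>_adj: "\<Phi> (\<nu> t) \<noteq> \<Phi> (\<nu> s)" if "t \<in> T'" "s \<in> T'" "t \<noteq> s" for t s
  proof (rule colour_proper)
    have "g t \<noteq> g s" using g that by (auto simp: bij_betw_def inj_on_def)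
    then show "exp_edges V R c (\<nu> t) (\<nu> s)"
      using that g_ne[of t s] g_ne[of s t] \<nu>_maps R_V by (fastforce simp: exp_edges_def \<nu>_def)
  qed
  have \<nu>_sec: "\<Phi> (\<nu> t) \<in> {..<k} - P" if t: "t \<in> T'" for t
  proof -
    \<comment> \<open>For \<open>b = t\<close>, the colour belongs to \<open>\<mu> t\<close>, which
      is adjacent to the lifted \<open>\<nu> t\<close>. For \<open>b = g t\<close>, the value is
      absent from the ball of radius 2 and is not \<open>bad\<close>. Any other \<open>b\<close> is
      omitted.\<close>
    have "\<Phi> (\<nu> t) \<noteq> \<Phi> (const b)" if b: "b < c" for b
    proof -
      consider "b = t" | "b = g t" | "b \<noteq> t" "b \<noteq> g t" by blast
      then show ?thesis
      proof cases
        case 1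
        have "exp_edges W (blowup R q) c (\<mu> t) (lift (\<nu> t))"
          unfolding exp_edges_def
        proof (intro conjI allI impI)
          fix u v assume uv: "blowup R q u v"
          obtain a i b j where ab: "u = (a, i)" "v = (b, j)" by fastforce
          have ij: "i < q" "j < q" "R a b" using uv ab by (auto simp: blowup_def)
          have W: "(a, i) \<in> W" "(b, j) \<in> W" "b \<in> V" using edge_W[OF uv] ab by (auto simp: W_def)
          \<comment> \<open>Hence wherever \<open>\<nu> t\<close> takes the value \<open>t\<close>,
            its neighbours carry codes below \<open>M\<close> under \<open>\<mu> t\<close>.\<close>
          have "B3 a" if "B2 b" using that R_sym[OF ij(3)] by (auto simp: B2_def B3_def)
          then show "\<mu> t u \<noteq> lift (\<nu> t) v"
            using W code_less[OF ij(1), of a] tT(1)[OF t] gS(1)[OF t] g_ne[OF t t]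
            by (auto simp: ab lift_app \<mu>_def \<nu>_def)
        qed (use \<mu>_maps tT(1)[OF t] lift_maps \<nu>_maps[OF t] in auto)
        then have "f (\<mu> t) \<noteq> \<Phi> (\<nu> t)" using f_proper by (simp add: \<Phi>_def)
        then show ?thesis using tT(2)[OF t] 1 by simp
      next
        case 2
        have "\<nu> t z \<noteq> g t" if "R x y" "R y z" for y z
          using that g_ne[OF t t] R_V by (auto simp: \<nu>_def B2_def)
        then show ?thesis using gS(2)[OF t] \<nu>_maps[OF t] b 2 by (auto simp: bad_def)
      next
        case 3
        then have "lift (\<nu> t) u \<noteq> b" if "u \<in> W" for u
          using that by (auto simp: lift_app \<nu>_def W_def)
        then show ?thesis
          using missing[of "lift (\<nu> t)" b] lift_maps \<nu>_maps[OF t] b by (simp add: \<Phi>_def)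
      qed
    qed
    then show ?thesis using colour_less \<nu>_maps[OF t] by (auto simp: P_def)
  qed
  have "card T' \<le> card ({..<k} - P)"
    by (rule card_inj_on_le[of "\<lambda>t. \<Phi> (\<nu> t)"]) (use \<nu>_adj \<nu>_sec in \<open>auto intro: inj_onI\<close>)
  then show False using T' card_sec by simp
qed

section \<open>Strong powers of the 9-cycle\<close>

text \<open>Bessel's inequality for an orthogonal family that is not normalised: \<open>C\<close>
  minus its projection, with coefficients \<open>t a\<close>, has nonnegative squared norm.\<close>

lemma bessel_weight:
  fixes U :: "'a \<Rightarrow> 'b \<Rightarrow> real" and C :: "'b \<Rightarrow> real"
  assumes "finite A" "finite J"
    and orth: "\<And>a b. a \<in> A \<Longrightarrow> b \<in> A \<Longrightarrow> a \<noteq> b \<Longrightarrow> (\<Sum>j\<in>J. U a j * U b j) = 0"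
    and pos: "\<And>a. a \<in> A \<Longrightarrow> (\<Sum>j\<in>J. U a j * U a j) > 0"
  shows "(\<Sum>a\<in>A. (\<Sum>j\<in>J. U a j * C j)\<^sup>2 / (\<Sum>j\<in>J. U a j * U a j)) \<le> (\<Sum>j\<in>J. C j * C j)"
proof -
  define s n where "s = (\<lambda>a. \<Sum>j\<in>J. U a j * C j)" and "n = (\<lambda>a. \<Sum>j\<in>J. U a j * U a j)"
  define t where "t = (\<lambda>a. s a / n a)"
  have cross: "(\<Sum>j\<in>J. C j * (\<Sum>a\<in>A. t a * U a j)) = (\<Sum>a\<in>A. t a * s a)"
    unfolding s_def sum_distrib_left by (subst sum.swap) (simp add: ac_simps)
  have "(\<Sum>j\<in>J. (\<Sum>a\<in>A. t a * U a j)\<^sup>2) = (\<Sum>j\<in>J. \<Sum>a\<in>A. \<Sum>b\<in>A. t a * t b * (U a j * U b j))"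
    unfolding power2_eq_square sum_product by (simp add: ac_simps)
  also have "\<dots> = (\<Sum>a\<in>A. \<Sum>b\<in>A. t a * t b * (\<Sum>j\<in>J. U a j * U b j))"
    unfolding sum_distrib_left by (subst sum.swap, intro sum.cong refl, rule sum.swap)
  also have "\<dots> = (\<Sum>a\<in>A. \<Sum>b\<in>A. if b = a then t a * t a * n a else 0)"
    by (intro sum.cong refl) (auto simp: orth n_def)
  also have "\<dots> = (\<Sum>a\<in>A. t a * t a * n a)"
    using assms(1) by simp
  also have "\<dots> = (\<Sum>a\<in>A. t a * s a)"
    using pos by (intro sum.cong refl) (force simp: t_def n_def)
  finally have sq: "(\<Sum>j\<in>J. (\<Sum>a\<in>A. t a * U a j)\<^sup>2) = (\<Sum>a\<in>A. t a * s a)" .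
  have "0 \<le> (\<Sum>j\<in>J. (C j - (\<Sum>a\<in>A. t a * U a j))\<^sup>2)"
    by (intro sum_nonneg) auto
  also have "\<dots> = (\<Sum>j\<in>J. C j * C j) - 2 * (\<Sum>j\<in>J. C j * (\<Sum>a\<in>A. t a * U a j))
      + (\<Sum>j\<in>J. (\<Sum>a\<in>A. t a * U a j)\<^sup>2)"
  proof -
    have "(C j - S)\<^sup>2 = C j * C j - 2 * (C j * S) + S\<^sup>2" for j S
      by (simp add: power2_eq_square algebra_simps)
    then show ?thesis by (simp only: sum.distrib sum_subtractf sum_distrib_left[symmetric])
  qed
  also have "\<dots> = (\<Sum>j\<in>J. C j * C j) - (\<Sum>a\<in>A. t a * s a)"
    unfolding cross sq by simp
  also have "(\<Sum>a\<in>A. t a * s a) = (\<Sum>a\<in>A. (s a)\<^sup>2 / n a)"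
    by (intro sum.cong refl) (simp add: t_def power2_eq_square)
  finally show ?thesis by (simp add: s_def n_def)
qed

section \<open>The weight bound for independent sets of strong powers\<close>

definition cyc9 :: "nat \<Rightarrow> nat \<Rightarrow> bool" where
  "cyc9 a b \<longleftrightarrow> a < 9 \<and> b < 9 \<and> (a = b \<or> b = Suc a mod 9 \<or> a = Suc b mod 9)"

text \<open>
  Vectors attached to the vertices of the 9-cycle, orthogonal for distinct non-adjacent vertices.
  Incidence vectors of the edges of a 9-cycle give total weight exactly 2 against the all-ones vector;
  tilting the last one towards the alternating vector keeps orthogonality and raises it to \<open>127/63\<close>.
\<close>

definition gram_vec :: "nat \<Rightarrow> nat \<Rightarrow> real" where
  "gram_vec a l =
     (if a = 8 then (if l = 0 \<or> l = 8 then 7 else if even l then -1 else 1)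
      else if l = a \<or> l = Suc a then 1 else 0)"

lemma lessThan_9: "{..<9::nat} = {0,1,2,3,4,5,6,7,8}"
  by auto

lemma gram_vec_orth:
  assumes "a < 9" "b < 9" "\<not> cyc9 a b"
  shows "(\<Sum>l<9. gram_vec a l * gram_vec b l) = 0"
proof -
  have "a \<in> {0,1,2,3,4,5,6,7,8}" "b \<in> {0,1,2,3,4,5,6,7,8}"
    using assms(1,2) lessThan_9 by blast+
  then show ?thesis using assms(3)
    unfolding lessThan_9 by (elim insertE; simp add: gram_vec_def cyc9_def)
qed

lemma gram_vec_norm:
  assumes "a < 9"
  shows "(\<Sum>l<9. gram_vec a l * gram_vec a l) = (if a = 8 then 105 else 2)"
proof -
  have "a \<in> {0,1,2,3,4,5,6,7,8}" using assms lessThan_9 by blast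
  then show ?thesis unfolding lessThan_9 by (elim insertE; simp add: gram_vec_def)
qed

lemma gram_vec_sum:
  assumes "a < 9"
  shows "(\<Sum>l<9. gram_vec a l) = (if a = 8 then 15 else 2)"
proof -
  have "a \<in> {0,1,2,3,4,5,6,7,8}" using assms lessThan_9 by blast
  then show ?thesis unfolding lessThan_9 by (elim insertE; simp add: gram_vec_def)
qed

definition vertices9 :: "nat \<Rightarrow> (nat \<Rightarrow> nat) set" where
  "vertices9 m = {..<m} \<rightarrow>\<^sub>E {..<9}"

definition strong9 :: "nat \<Rightarrow> (nat \<Rightarrow> nat) \<Rightarrow> (nat \<Rightarrow> nat) \<Rightarrow> bool" where
  "strong9 m a b \<longleftrightarrow> a \<in> vertices9 m \<and> b \<in> vertices9 m \<and> (\<forall>i<m. cyc9 (a i) (b i))"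

text \<open>The factors are \<open>(\<Sum>l. u l)\<^sup>2 / (9 * \<parallel>u\<parallel>\<^sup>2)\<close> for the vectors \<open>u = gram_vec a\<close>.\<close>

definition weight9 :: "nat \<Rightarrow> (nat \<Rightarrow> nat) \<Rightarrow> real" where
  "weight9 m a = (\<Prod>i<m. if a i = 8 then 5/21 else 2/9)"

lemma finite_vertices9: "finite (vertices9 m)"
  by (simp add: vertices9_def finite_PiE)

text \<open>The sum factorises over coordinates, each contributing
  \<open>8 * 2/9 + 5/21 = 127/63\<close>.\<close>

lemma sum_weight9: "(\<Sum>a\<in>vertices9 m. weight9 m a) = (127/63) ^ m"
proof -
  have "(\<Sum>a\<in>vertices9 m. weight9 m a) = (\<Prod>i<m. \<Sum>l<9. if l = (8::nat) then 5/21 else 2/9 :: real)"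
    unfolding weight9_def vertices9_def by (rule prod_sum_PiE[symmetric]) auto
  then show ?thesis by (simp add: lessThan_9)
qed

text \<open>Distinct non-adjacent vertices have a non-adjacent coordinate, so their tensor products
  of \<open>gram_vec\<close> are orthogonal. Bessel against the all-ones vector, of squared norm
  \<open>9 ^ m\<close>, gives the bound.\<close>

lemma weight9_independent:
  assumes A: "A \<subseteq> vertices9 m"
    and ind: "\<And>a b. a \<in> A \<Longrightarrow> b \<in> A \<Longrightarrow> a \<noteq> b \<Longrightarrow> \<not> strong9 m a b"
  shows "(\<Sum>a\<in>A. weight9 m a) \<le> 1"
proof -
  define U where "U = (\<lambda>(a::nat\<Rightarrow>nat) j. \<Prod>i<m. gram_vec (a i) (j i))"
  have dot: "(\<Sum>j\<in>vertices9 m. U a j * U b j) = (\<Prod>i<m. \<Sum>l<9. gram_vec (a i) l * gram_vec (b i) l)" for a b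
    unfolding U_def vertices9_def prod.distrib[symmetric]
    by (rule prod_sum_PiE[symmetric]) auto
  have sm: "(\<Sum>j\<in>vertices9 m. U a j * 1) = (\<Prod>i<m. \<Sum>l<9. gram_vec (a i) l)" for a
    unfolding U_def vertices9_def mult_1_right by (rule prod_sum_PiE[symmetric]) auto
  have lt: "a i < 9" if "a \<in> A" "i < m" for a i
    using that A by (auto simp: vertices9_def PiE_iff)
  have nrm: "(\<Sum>j\<in>vertices9 m. U a j * U a j) = (\<Prod>i<m. if a i = 8 then 105 else 2)" if "a \<in> A" for a
    unfolding dot using that lt by (intro prod.cong) (auto simp: gram_vec_norm)
  have sums: "(\<Sum>j\<in>vertices9 m. U a j * 1) = (\<Prod>i<m. if a i = 8 then 15 else 2)" if "a \<in> A" for a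
    unfolding sm using that lt by (intro prod.cong) (auto simp: gram_vec_sum)
  have "(\<Sum>a\<in>A. (\<Sum>j\<in>vertices9 m. U a j * 1)\<^sup>2 / (\<Sum>j\<in>vertices9 m. U a j * U a j))
      \<le> (\<Sum>j\<in>vertices9 m. 1 * 1)"
  proof (rule bessel_weight)
    show "finite A" using A finite_vertices9 finite_subset by blast
    show "(\<Sum>j\<in>vertices9 m. U a j * U b j) = 0" if "a \<in> A" "b \<in> A" "a \<noteq> b" for a b
    proof -
      have "\<not> strong9 m a b" "a \<in> vertices9 m" "b \<in> vertices9 m" using ind that A by blast+
      then obtain i where "i < m" "\<not> cyc9 (a i) (b i)"
        by (auto simp: strong9_def)
      then have "\<exists>i\<in>{..<m}. (\<Sum>l<9. gram_vec (a i) l * gram_vec (b i) l) = 0"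
        using gram_vec_orth[of "a i" "b i"] lt that by auto
      then show ?thesis unfolding dot by simp
    qed
    show "(\<Sum>j\<in>vertices9 m. U a j * U a j) > 0" if "a \<in> A" for a
      unfolding nrm[OF that] by (intro prod_pos) auto
  qed (rule finite_vertices9)
  also have "(\<Sum>j\<in>vertices9 m. 1 * 1) = (9 ^ m :: real)"
    by (simp add: vertices9_def card_PiE)
  also have "(\<Sum>a\<in>A. (\<Sum>j\<in>vertices9 m. U a j * 1)\<^sup>2 / (\<Sum>j\<in>vertices9 m. U a j * U a j))
      = (\<Sum>a\<in>A. 9 ^ m * weight9 m a)"
  proof (rule sum.cong[OF refl])
    fix a assume a: "a \<in> A"
    have "9 ^ m * weight9 m a = (\<Prod>i<m. 9) * weight9 m a" by simp
    \<comment> \<open>Coordinatewise, \<open>9 * 5/21 = 15^2 / 105\<close> and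
      \<open>9 * 2/9 = 2^2 / 2\<close>.\<close>
    also have "\<dots> = (\<Prod>i<m. (if a i = 8 then 15 else 2)\<^sup>2 / (if a i = 8 then 105 else 2))"
      unfolding weight9_def prod.distrib[symmetric] by (intro prod.cong) auto
    also have "\<dots> = (\<Sum>j\<in>vertices9 m. U a j * 1)\<^sup>2 / (\<Sum>j\<in>vertices9 m. U a j * U a j)"
      unfolding nrm[OF a] sums[OF a] prod_dividef prod_power_distrib by simp
    finally show "(\<Sum>j\<in>vertices9 m. U a j * 1)\<^sup>2 / (\<Sum>j\<in>vertices9 m. U a j * U a j) = 9 ^ m * weight9 m a"
      by simp
  qed
  finally show ?thesis by (simp add: sum_distrib_left[symmetric])
qed

section \<open>Colouring balls of radius 3 by parities\<close>

text \<open>Rotates the cycle so that \<open>x\<close> moves to 3 and its ball of radius 3 becomes the path \<open>0, \<dots>, 6\<close>.\<close>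

definition offset9 :: "nat \<Rightarrow> nat \<Rightarrow> nat" where
  "offset9 x a = (a + (12 - x)) mod 9"

lemma cyc9_offset9:
  assumes "cyc9 a b"
  shows "cyc9 (offset9 x a) (offset9 x b)"
proof -
  have step: "offset9 x (Suc u mod 9) = Suc (offset9 x u) mod 9" for u
    unfolding offset9_def by (simp only: mod_add_left_eq mod_Suc_eq add_Suc)
  have lt: "offset9 x u < 9" for u by (simp add: offset9_def)
  from assms consider "a = b" | "b = Suc a mod 9" | "a = Suc b mod 9"
    unfolding cyc9_def by blast
  then show ?thesis
    unfolding cyc9_def using lt[of a] lt[of b] step[of a] step[of b] by cases simp_all
qed

lemma offset9_inj:
  assumes "a < 9" "b < 9" "offset9 x a = offset9 x b"
  shows "a = b"
proof -
  have "u = v" if "u \<le> v" "v < 9" "offset9 x u = offset9 x v" for u v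
  proof -
    have "9 dvd (v + (12 - x)) - (u + (12 - x))"
      using that by (subst mod_eq_dvd_iff_nat[symmetric]) (auto simp: offset9_def)
    then have "9 dvd v - u" by simp
    then show ?thesis using that(1,2) by (auto dest!: dvd_imp_le)
  qed
  from this[of a b] this[of b a] show ?thesis using assms by (cases "a \<le> b") auto
qed

text \<open>Below 7 the edge between 8 and 0 cannot occur, so distinct neighbours are consecutive
  integers.\<close>

lemma cyc9_parity:
  assumes "cyc9 p q" "p \<noteq> q" "p < 7" "q < 7"
  shows "even p \<noteq> even q"
proof -
  have "q = Suc p \<or> p = Suc q" using assms by (simp add: cyc9_def)
  then show ?thesis by auto
qed

lemma offset9_step:
  assumes "cyc9 a b" "a \<noteq> b" "offset9 x a < 7" "offset9 x b < 7"
  shows "even (offset9 x a) \<noteq> even (offset9 x b)"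
proof (rule cyc9_parity)
  show "cyc9 (offset9 x a) (offset9 x b)" using assms(1) by (rule cyc9_offset9)
  show "offset9 x a \<noteq> offset9 x b" using assms(1,2) offset9_inj by (auto simp: cyc9_def)
qed fact+

lemma cyc9_three_steps:
  assumes "cyc9 3 p" "cyc9 p q" "cyc9 q r"
  shows "r < 7"
proof -
  have "p \<in> {2, 3, 4}" using assms(1) by (auto simp: cyc9_def mod_Suc split: if_splits)
  then have "q \<in> {1, 2, 3, 4, 5}" using assms(2) by (auto simp: cyc9_def mod_Suc split: if_splits)
  then show ?thesis using assms(3) by (auto simp: cyc9_def mod_Suc split: if_splits)
qed

lemma offset9_ball:
  assumes "cyc9 x y" "cyc9 y z" "cyc9 z w"
  shows "offset9 x w < 7"
proof (rule cyc9_three_steps)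
  \<comment> \<open>\<open>12 - x\<close> is \<open>3 - x\<close> plus a full turn of 9, which keeps
    natural subtraction exact for \<open>x < 9\<close>.\<close>
  have "offset9 x x = 3" using assms(1) by (simp add: cyc9_def offset9_def)
  then show "cyc9 3 (offset9 x y)" using cyc9_offset9[OF assms(1), of x] by simp
qed (use assms cyc9_offset9 in blast)+

lemma strong9_offset9_ball:
  assumes "strong9 m x y" "strong9 m y z" "strong9 m z w" "i < m"
  shows "offset9 (x i) (w i) < 7"
proof (rule offset9_ball)
  show "cyc9 (x i) (y i)" "cyc9 (y i) (z i)" "cyc9 (z i) (w i)"
    using assms by (simp_all add: strong9_def)
qed

text \<open>The colour encodes the vector of parities of the rotated coordinates. Distinct adjacent
  vertices differ in some coordinate, where they are neighbours on the path \<open>0, ..., 6\<close>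
  and so have opposite parities.\<close>

lemma strong9_ball_colouring:
  "\<exists>col :: (nat \<Rightarrow> nat) \<Rightarrow> nat. (\<forall>a. col a < 2 ^ m) \<and>
    (\<forall>a b. a \<noteq> b \<longrightarrow> strong9 m a b \<longrightarrow>
      (\<exists>y z. strong9 m x y \<and> strong9 m y z \<and> strong9 m z a) \<longrightarrow>
      (\<exists>y z. strong9 m x y \<and> strong9 m y z \<and> strong9 m z b) \<longrightarrow> col a \<noteq> col b)"
proof -
  define D where "D = {..<m} \<rightarrow>\<^sub>E (UNIV :: bool set)"
  have D: "finite D" "card D = 2 ^ m" by (auto simp: D_def finite_PiE card_PiE)
  then obtain f where f: "bij_betw f D {0..<2 ^ m :: nat}" using ex_bij_betw_finite_nat[of D] by auto
  define g where "g = (\<lambda>a. \<lambda>i\<in>{..<m}. even (offset9 (x i) (a i)))"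
  have gD: "g a \<in> D" for a by (auto simp: g_def D_def)
  have "f (g a) < 2 ^ m" for a using bij_betwE[OF f] gD[of a] by auto
  moreover have "f (g a) \<noteq> f (g b)"
    if "a \<noteq> b" and ab: "strong9 m a b" and "strong9 m x y" "strong9 m y z" "strong9 m z a"
      "strong9 m x y'" "strong9 m y' z'" "strong9 m z' b" for a b y z y' z'
  proof
    assume "f (g a) = f (g b)"
    then have eq: "g a = g b" using f gD by (auto simp: bij_betw_def inj_on_def)
    obtain i where i: "i < m" "a i \<noteq> b i"
      using ab \<open>a \<noteq> b\<close> unfolding strong9_def vertices9_def by (metis PiE_ext lessThan_iff)
    have "cyc9 (a i) (b i)" using ab i by (auto simp: strong9_def)
    moreover have "offset9 (x i) (a i) < 7" "offset9 (x i) (b i) < 7"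
      using strong9_offset9_ball[OF that(3-5) i(1)] strong9_offset9_ball[OF that(6-8) i(1)] by auto
    ultimately have "even (offset9 (x i) (a i)) \<noteq> even (offset9 (x i) (b i))"
      using offset9_step i by blast
    then show False using fun_cong[OF eq, of i] i by (simp add: g_def)
  qed
  ultimately show ?thesis by (intro exI[of _ "\<lambda>a. f (g a)"]) blast
qed

section \<open>The pair of graphs\<close>

lemma proper_colouring_mono:
  "proper_colouring V E k f \<Longrightarrow> k \<le> l \<Longrightarrow> proper_colouring V E l f"
  by (fastforce simp: proper_colouring_def)

lemma chromatic_number_le: "proper_colouring V E k f \<Longrightarrow> chromatic_number V E \<le> k"
  unfolding chromatic_number_def by (rule Least_le) blast

text \<open>\<open>LEAST\<close> is attained only if some colouring exists; an injective numbering
  of the finite vertex set supplies one.\<close>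

lemma chromatic_number_greater:
  assumes G: "simple_graph V E" and no: "\<And>f. \<not> proper_colouring V E k f"
  shows "k < chromatic_number V E"
proof (rule ccontr)
  assume "\<not> k < chromatic_number V E"
  then have le: "chromatic_number V E \<le> k" by simp
  have "finite V" using G by (simp add: simple_graph_def)
  then obtain g where "bij_betw g V {0..<card V}" using ex_bij_betw_finite_nat by blast
  then have "proper_colouring V E (card V) g"
    unfolding proper_colouring_def
  proof (intro conjI ballI allI impI)
    assume g: "bij_betw g V {0..<card V}"
    show "g v < card V" if "v \<in> V" for v using bij_betwE[OF g] that by simp
    fix x y assume "E x y"
    then have "x \<in> V" "y \<in> V" "x \<noteq> y" using G by (auto simp: simple_graph_def)
    then show "g x \<noteq> g y" using bij_betw_imp_inj_on[OF g] by (auto dest: inj_onD)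
  qed
  then have "\<exists>k f. proper_colouring V E k f" by blast
  then have "\<exists>f. proper_colouring V E (chromatic_number V E) f"
    unfolding chromatic_number_def by (rule LeastI_ex)
  then show False using no proper_colouring_mono[OF _ le] by blast
qed

text \<open>Moves graphs whose vertices are pairs or functions onto natural numbers. The
  homomorphism \<open>r\<close> back to the original lets the evaluation colouring be
  transported.\<close>

lemma nat_copy:
  assumes G: "simple_graph V E" and no: "\<And>f. \<not> proper_colouring V E k f"
  obtains VN :: "nat set" and EN and r where "simple_graph VN EN" "k < chromatic_number VN EN"
    "\<And>i. i \<in> VN \<Longrightarrow> r i \<in> V" "\<And>i j. EN i j \<Longrightarrow> E (r i) (r j)"
proof -
  have "finite V" using G by (simp add: simple_graph_def)
  then obtain g where g: "bij_betw g V {0..<card V}" using ex_bij_betw_finite_nat by blast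
  define r where "r = inv_into V g"
  have r: "r i \<in> V" if "i < card V" for i
    unfolding r_def by (rule inv_into_into) (use bij_betw_imp_surj_on[OF g] that in simp)
  have rg: "r (g v) = v" "g v < card V" if "v \<in> V" for v
    using bij_betw_inv_into_left[OF g] bij_betwE[OF g] that by (auto simp: r_def)
  define EN where "EN = (\<lambda>i j. i < card V \<and> j < card V \<and> E (r i) (r j))"
  have simple: "simple_graph {..<card V} EN"
    using G unfolding simple_graph_def EN_def by auto
  have "\<not> proper_colouring {..<card V} EN k f" for f
  proof
    assume "proper_colouring {..<card V} EN k f"
    moreover have "EN (g x) (g y)" if "E x y" for x y
    proof -
      have "x \<in> V" "y \<in> V" using G that by (auto simp: simple_graph_def)
      then show ?thesis using rg that by (simp add: EN_def)
    qed
    ultimately have "proper_colouring V E k (f \<circ> g)"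
      using rg by (auto simp: proper_colouring_def)
    then show False using no by blast
  qed
  with simple have "k < chromatic_number {..<card V} EN" by (rule chromatic_number_greater)
  with simple show ?thesis
    by (rule that[of "{..<card V}" EN r]) (simp_all add: r EN_def)
qed

text \<open>A loop at a map would be a proper \<open>c\<close>-colouring of \<open>E\<close>,
  excluded by \<open>no\<close>.\<close>

lemma simple_graph_exp:
  assumes G: "simple_graph V E" and no: "\<And>f. \<not> proper_colouring V E c f"
  shows "simple_graph (colour_maps V c) (exp_edges V E c)"
proof -
  have "\<not> exp_edges V E c \<phi> \<phi>" for \<phi>
    using no[of \<phi>] by (auto simp: exp_edges_def proper_colouring_def colour_maps_def)
  moreover have "exp_edges V E c \<psi> \<phi>" if "exp_edges V E c \<phi> \<psi>" for \<phi> \<psi>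
    using that G unfolding exp_edges_def simple_graph_def by metis
  ultimately show ?thesis
    using G unfolding simple_graph_def by (auto simp: finite_maps exp_edges_def)
qed

lemma tensor_exp_graph_pair:
  assumes G: "simple_graph V E" and "c \<le> k"
    and noG: "\<And>f. \<not> proper_colouring V E k f"
    and noH: "\<And>f. \<not> proper_colouring (colour_maps V c) (exp_edges V E c) k f"
  shows "\<exists>(VG :: nat set) EG (VH :: nat set) EH. simple_graph VG EG \<and> simple_graph VH EH \<and>
    k < chromatic_number VG EG \<and> k < chromatic_number VH EH \<and>
    chromatic_number (tensor_vertices VG VH) (tensor_edges EG EH) \<le> c"
proof -
  obtain VG :: "nat set" and EG r where 1: "simple_graph VG EG" "k < chromatic_number VG EG"
    "\<And>i. i \<in> VG \<Longrightarrow> r i \<in> V" "\<And>i j. EG i j \<Longrightarrow> E (r i) (r j)"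
    by (rule nat_copy[OF G noG]) (rule that)
  have H: "simple_graph (colour_maps V c) (exp_edges V E c)"
    using simple_graph_exp[OF G] noG proper_colouring_mono[OF _ \<open>c \<le> k\<close>] by blast
  obtain VH :: "nat set" and EH s where 2: "simple_graph VH EH" "k < chromatic_number VH EH"
    "\<And>i. i \<in> VH \<Longrightarrow> s i \<in> colour_maps V c" "\<And>i j. EH i j \<Longrightarrow> exp_edges V E c (s i) (s j)"
    by (rule nat_copy[OF H noH]) (rule that)
  \<comment> \<open>Evaluation of a map at a vertex: adjacency in the exponential graph says exactly
    that this is proper on the product.\<close>
  have "proper_colouring (tensor_vertices VG VH) (tensor_edges EG EH) c (\<lambda>(i, j). s j (r i))"
    using 1(3,4) 2(3,4)
    by (fastforce simp: proper_colouring_def tensor_vertices_def tensor_edges_def exp_edges_def colour_maps_def)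
  then show ?thesis using 1(1,2) 2(1,2) chromatic_number_le by blast
qed

section \<open>Chromatic number of the blow-up and choice of parameters\<close>

lemma simple_graph_blowup:
  assumes "finite V" "\<And>x y. R x y \<Longrightarrow> x \<in> V \<and> y \<in> V" "\<And>x y. R x y \<Longrightarrow> R y x"
  shows "simple_graph (V \<times> {..<q}) (blowup R q)"
  using assms by (auto simp: simple_graph_def blowup_def mem_Times_iff)

text \<open>A colour class of the blow-up projects injectively onto an independent set, hence has
  weight at most 1, while the total weight is \<open>q * sum w V\<close>.\<close>

lemma blowup_not_colourable:
  fixes w :: "'a \<Rightarrow> real"
  assumes V: "finite V" and refl: "\<And>x. x \<in> V \<Longrightarrow> R x x"
    and w: "\<And>A. A \<subseteq> V \<Longrightarrow> (\<And>a b. a \<in> A \<Longrightarrow> b \<in> A \<Longrightarrow> a \<noteq> b \<Longrightarrow> \<not> R a b) \<Longrightarrow> sum w A \<le> 1"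
    and k: "real k < real q * sum w V"
  shows "\<not> proper_colouring (V \<times> {..<q}) (blowup R q) k f"
proof
  define W where "W = V \<times> {..<q}"
  assume "proper_colouring (V \<times> {..<q}) (blowup R q) k f"
  then have f: "\<And>u. u \<in> W \<Longrightarrow> f u < k" "\<And>u v. blowup R q u v \<Longrightarrow> f u \<noteq> f v"
    by (auto simp: proper_colouring_def W_def)
  have "real q * sum w V = (\<Sum>u\<in>W. w (fst u))"
    by (simp add: W_def sum.cartesian_product' sum_distrib_left)
  also have "\<dots> = (\<Sum>j<k. \<Sum>u\<in>{u\<in>W. f u = j}. w (fst u))"
    using f(1) V by (intro sum.group[symmetric]) (auto simp: W_def)
  also have "\<dots> \<le> (\<Sum>j<k. 1)"
  proof (rule sum_mono)
    fix j
    define C where "C = {u\<in>W. f u = j}"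
    have nonadj: "\<not> R (fst u) (fst v)" if "u \<in> C" "v \<in> C" "u \<noteq> v" for u v
      using that f(2)[of u v] by (auto simp: C_def W_def blowup_def)
    have inj: "inj_on fst C"
    proof (rule inj_onI, rule ccontr)
      fix u v assume uv: "u \<in> C" "v \<in> C" "fst u = fst v" "u \<noteq> v"
      then have "fst u \<in> V" by (auto simp: C_def W_def)
      with uv nonadj refl show False by metis
    qed
    have "(\<Sum>u\<in>C. w (fst u)) = sum w (fst ` C)"
      using inj by (simp add: sum.reindex)
    also have "\<dots> \<le> 1"
      using nonadj by (intro w) (auto simp: C_def W_def)
    finally show "(\<Sum>u\<in>{u\<in>W. f u = j}. w (fst u)) \<le> 1" by (simp add: C_def)
  qed
  finally show False using k by simp
qed

text \<open>For fixed \<open>N\<close> the left side has order at most \<open>c ^ (N - 1)\<close>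
  and the right side order \<open>c ^ N\<close>; \<open>c div 10\<close> is at least
  \<open>c / 20\<close> once \<open>20 \<le> c\<close>.\<close>

lemma robustness_bound:
  fixes c N :: nat
  assumes N: "2 \<le> N" and c: "2 * N ^ 4 * 20 ^ N < c" "20 \<le> c" and k: "k \<le> 2 * c"
  shows "k * N ^ 4 * c ^ (N - 2) < (c div 10) ^ N"
proof (rule ccontr)
  assume "\<not> ?thesis"
  then have le: "(c div 10) ^ N \<le> k * N ^ 4 * c ^ (N - 2)" by simp
  have "c ^ N \<le> (20 * (c div 10)) ^ N"
    using c(2) by (intro power_mono) auto
  also have "\<dots> = 20 ^ N * (c div 10) ^ N" by (rule power_mult_distrib)
  also have "\<dots> \<le> 20 ^ N * (2 * c * N ^ 4 * c ^ (N - 2))"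
    using le k by (meson le_trans mult_le_mono1 mult_le_mono2)
  also have "\<dots> = 2 * N ^ 4 * 20 ^ N * (c * c ^ (N - 2))" by simp
  also have "\<dots> < c * (c * c ^ (N - 2))"
    using c by (intro mult_strict_right_mono) auto
  also have "\<dots> = c ^ N"
    using N by (metis le_add_diff_inverse power_Suc add_2_eq_Suc)
  finally show False by simp
qed

lemma strong9_vertices9: "strong9 m x y \<Longrightarrow> x \<in> vertices9 m \<and> y \<in> vertices9 m"
  and strong9_refl: "x \<in> vertices9 m \<Longrightarrow> strong9 m x x"
  and strong9_sym: "strong9 m x y \<Longrightarrow> strong9 m y x"
  by (auto simp: strong9_def cyc9_def vertices9_def PiE_iff)

theorem theorem1:
  shows "\<exists>\<delta>::real. \<delta> \<ge> 10 powr (-9) \<and>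
    (\<forall>\<^sub>F c in sequentially.
       \<exists>(VG :: nat set) EG (VH :: nat set) EH.
         simple_graph VG EG \<and> simple_graph VH EH \<and>
         real (chromatic_number VG EG) \<ge> (1 + \<delta>) * real c \<and>
         real (chromatic_number VH EH) \<ge> (1 + \<delta>) * real c \<and>
         chromatic_number (tensor_vertices VG VH) (tensor_edges EG EH) \<le> c)"
proof (intro exI[of _ "1/100"] conjI)
  have "(10::real) powr (-9) = 1 / 10 ^ 9"
    by (simp add: powr_minus_divide powr_numeral)
  then show "(10::real) powr (-9) \<le> 1/100" by simp
  \<comment> \<open>Each coordinate gains a factor \<open>127/126\<close> of weight
    \<open>127/63\<close> over the 2 colours of a ball; \<open>m\<close> makes the total gain exceed
    4.\<close>
  obtain m where m: "(4::real) < (127/126) ^ m"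
    using real_arch_pow[of "127/126" 4] by auto
  define N K where "N = (9::nat) ^ m" and "K = (2::nat) ^ m"
  have "m > 0" using m by (cases m) auto
  then have "9 ^ 1 \<le> N" unfolding N_def by (intro power_increasing) auto
  then have N: "2 \<le> N" by simp
  have card: "card (vertices9 m) = N"
    by (simp add: vertices9_def card_PiE N_def)
  have K: "K > 0" by (simp add: K_def)
  have "real K * 4 < real K * (127/126) ^ m" using m K by simp
  also have "\<dots> = (127/63) ^ m" by (simp add: K_def power_mult_distrib[symmetric])
  finally have W: "real K * 4 < (127/63) ^ m" .
  show "\<forall>\<^sub>F c in sequentially. \<exists>(VG :: nat set) EG (VH :: nat set) EH.
         simple_graph VG EG \<and> simple_graph VH EH \<and>
         real (chromatic_number VG EG) \<ge> (1 + 1/100) * real c \<and>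
         real (chromatic_number VH EH) \<ge> (1 + 1/100) * real c \<and>
         chromatic_number (tensor_vertices VG VH) (tensor_edges EG EH) \<le> c"
    using eventually_gt_at_top[of "2 * N ^ 4 * 20 ^ N"] eventually_ge_at_top[of "20 * K"]
  proof eventually_elim
    case (elim c)
    \<comment> \<open>Up to rounding \<open>c\<close> is \<open>3 * (K * q)\<close>: coding a ball
      costs a third of the colours, while the blow-up needs more than
      \<open>4 * (K * q)\<close>.\<close>
    define q k where "q = c div (3 * K)" and "k = c + c div 100"
    have c20: "20 \<le> c" using elim(2) K by linarith
    have "(3 * K) * q \<le> c" unfolding q_def by (rule times_div_less_eq_dividend)
    then have q1: "3 * (K * q) \<le> c" by simp
    have "c < (3 * K) * Suc q" unfolding q_def using K dividend_less_times_div[of "3 * K" c] by simp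
    then have q2: "c < 3 * (K * q) + 3 * K" by simp
    \<comment> \<open>As \<open>20 * K \<le> c\<close>, rounding loses at most
      \<open>3 * c / 20\<close>, so \<open>4 * (K * q)\<close> still exceeds
      \<open>17 * c / 15\<close>.\<close>
    have k4: "k \<le> 4 * (K * q)" using q2 elim(2) unfolding k_def by linarith
    have q0: "q > 0" using k4 c20 unfolding k_def by (cases q) auto
    have "\<not> proper_colouring (vertices9 m \<times> {..<q}) (blowup (strong9 m) q) k f" for f
    proof (rule blowup_not_colourable)
      have "real k \<le> real (4 * (K * q))" using k4 by (rule of_nat_mono)
      also have "\<dots> = real q * (real K * 4)" by simp
      also have "\<dots> < real q * (127/63) ^ m" using q0 W by (intro mult_strict_left_mono) auto
      finally show "real k < real q * sum (weight9 m) (vertices9 m)" by (simp add: sum_weight9)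
    qed (auto simp: finite_vertices9 strong9_vertices9 strong9_refl strong9_sym intro: weight9_independent)
    moreover have "\<not> proper_colouring (colour_maps (vertices9 m \<times> {..<q}) c)
        (exp_edges (vertices9 m \<times> {..<q}) (blowup (strong9 m) q) c) k f" for f
    proof (rule exp_graph_not_colourable[where K = K and h = "c div 10"])
      show "k * card (vertices9 m) ^ 4 * c ^ (card (vertices9 m) - 2) < (c div 10) ^ card (vertices9 m)"
        unfolding card by (rule robustness_bound) (use N elim(1) c20 in \<open>auto simp: k_def\<close>)
      \<comment> \<open>The fractions of \<open>c\<close> involved are \<open>2/3 + 2/100\<close>
        and \<open>1/3 + 1/10 + 3/100\<close>; the summand 2 is absorbed by
        \<open>20 \<le> c\<close>.\<close>
      show "2 * (K * q) + 2 * (k - c) < c" "K * q + c div 10 + 3 * (k - c) + 2 \<le> c"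
        using q1 c20 unfolding k_def by linarith+
    qed (use strong9_ball_colouring[of m] in \<open>auto simp: finite_vertices9 strong9_vertices9 strong9_refl strong9_sym K_def\<close>)
    moreover have "simple_graph (vertices9 m \<times> {..<q}) (blowup (strong9 m) q)"
      by (intro simple_graph_blowup) (auto simp: finite_vertices9 strong9_vertices9 strong9_refl strong9_sym)
    ultimately obtain VG EG VH EH where *: "simple_graph (VG :: nat set) EG" "simple_graph (VH :: nat set) EH"
      "k < chromatic_number VG EG" "k < chromatic_number VH EH"
      "chromatic_number (tensor_vertices VG VH) (tensor_edges EG EH) \<le> c"
      using tensor_exp_graph_pair[of "vertices9 m \<times> {..<q}" "blowup (strong9 m) q" c k]
      unfolding k_def by auto
    \<comment> \<open>The strict inequality \<open>k < n\<close> makes up for the rounding in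
      \<open>c div 100\<close>.\<close>
    have "(1 + 1/100) * real c \<le> real n" if "k < n" for n
    proof -
      have "101 * c \<le> 100 * n" using that unfolding k_def by linarith
      then have "real (101 * c) \<le> real (100 * n)" by (rule of_nat_mono)
      then show ?thesis by (simp add: field_simps)
    qed
    with * show ?case by blast
  qed
qed

end
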